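(* Let $\eta : [2,\infty) \to (0,\infty)$ be any function with $\eta(y) \to 0$ as $y \to \infty$. There is a constant $C > 0$ (depending at most on $\eta$, and not on $k, w, x, y$) such that for every real $k > 1$ and all real numbers $w, y, x$ with $2 \le w \le y \le x$ and $\log w \le \eta(y) \log y$, $$\#\Bigl\{ n \in \mathbb{Z} : x < n \le x+y,\ n \text{ is } k\text{-powered},\ p^{+}(q(n)) \le w \Bigr\} \ \le\ C \left( \frac{y \log w}{\log y} + y \exp\Bigl( - \frac{\log y}{3 \log w} \Bigr) + y^{11/12} \right).$$
   Context: For a positive integer $n$, $\kappa(n) := \prod_{p \mid n} p$ (product over distinct primes dividing $n$) is the squarefree kernel of $n$. For a real number $k \ge 1$, a positive integer $n$ is called $k$-powered if $\kappa(n) \le n^{1/k}$. The squarefree part of $n$ is $q(n) := \prod_{p \mid n,\ p^2 \nmid n} p$, the product of the primes dividing $n$ exactly once. For an integer $m \ge 2$, $p^{+}(m)$ denotes the largest prime factor of $m$, with the convention $p^{+}(1) = 1$. *)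

theory Defs
  imports "HOL-Analysis.Analysis" "HOL-Computational_Algebra.Primes"
begin

definition sqfree_kernel :: "nat \<Rightarrow> nat" where
  "sqfree_kernel n = (\<Prod>p\<in>prime_factors n. p)"

definition k_powered :: "real \<Rightarrow> nat \<Rightarrow> bool" where
  "k_powered k n \<longleftrightarrow> n > 0 \<and> real (sqfree_kernel n) \<le> real n powr (1 / k)"

(* Not the squarefree_part of HOL-Computational_Algebra.Squarefree, which keeps the primes of
   odd multiplicity: here only the primes of multiplicity exactly one contribute. *)
definition simple_prime_part :: "nat \<Rightarrow> nat" where
  "simple_prime_part n = (\<Prod>p\<in>{p \<in> prime_factors n. \<not> p\<^sup>2 dvd n}. p)"

definition largest_prime_factor :: "nat \<Rightarrow> nat" where
  "largest_prime_factor m = (if m \<ge> 2 then Max (prime_factors m) else 1)"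

end

theory Submission
  imports Defs "HOL-Computational_Algebra.Squarefree" "HOL-Number_Theory.Cong"
begin

text \<open>If the largest prime factor of the squarefree part of \<open>n\<close> is at most \<open>w\<close>, then no prime
  \<open>p > w\<close> divides \<open>n\<close> exactly once. For each such \<open>p\<close> this removes \<open>p - 1\<close> of the \<open>p\<^sup>2\<close> residue
  classes modulo \<open>p\<^sup>2\<close>, a proportion close to \<open>1 / p\<close>. This is a sieve of dimension one with the
  primes in \<open>(w, D]\<close>, where \<open>D\<close> is a small power of \<open>y\<close>, and so about \<open>y * ln w / ln y\<close> integers of
  an interval of length \<open>y\<close> should survive, wherever the interval lies. An upper bound of this
  order holds with an additional error of \<open>y powr (1 / 2)\<close>.

  The upper bound sieve (\<open>selberg_sieve\<close>) is Selberg's, in an orthogonal form. Attach to \<open>p\<close> the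
  function of mean zero modulo \<open>p\<^sup>2\<close> that is \<open>-1\<close> on the removed classes and a constant
  \<open>h p\<close> elsewhere. By the Chinese remainder theorem the products of these functions over different
  sets of primes are orthogonal over a full period. Their sum \<open>F\<close>, over the sets of primes with
  product at most \<open>D\<close>, takes on survivors the value \<open>G\<close>, the sum of the products of the \<open>h p\<close>, and
  has mean square \<open>G\<close>. So the survivors number at most \<open>y / G\<close>, up to the effect of incomplete periods.

  It remains to see that \<open>G\<close> is at least of order \<open>ln D / ln w\<close>. Since \<open>h p\<close> is essentially
  \<open>1 / p\<close>, \<open>G\<close> is essentially the sum of \<open>1 / d\<close> over squarefree \<open>d \<le> D\<close> without prime factors up to
  \<open>w\<close>. Splitting off from each \<open>m \<le> D\<close> a square and its small primes (\<open>ln_le_rough_sum\<close>) compares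
  this sum with the harmonic sum, and the small primes contribute a factor of order \<open>ln w\<close>, by an
  upper bound of Mertens type (\<open>prod_one_plus_inverse_primes_le\<close>).\<close>

section \<open>Sums of periodic functions\<close>

lemma sum_periodic_shift:
  fixes f :: "nat \<Rightarrow> real"
  assumes "\<And>n. f (n + M) = f n"
  shows "(\<Sum>n\<in>{a..<a + M}. f n) = (\<Sum>n<M. f n)"
proof (induction a)
  case 0
  then show ?case by (simp add: atLeast0LessThan)
next
  case (Suc a)
  have "f a + (\<Sum>n\<in>{Suc a..<Suc a + M}. f n) = (\<Sum>n\<in>{a..<Suc (a + M)}. f n)"
    using sum.atLeast_Suc_lessThan[of a "Suc (a + M)" f] by simp
  also have "\<dots> = (\<Sum>n\<in>{a..<a + M}. f n) + f (a + M)"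
    by simp
  finally show ?case using Suc assms[of a] by simp
qed

lemma sum_periodic_blocks:
  fixes f :: "nat \<Rightarrow> real"
  assumes "\<And>n. f (n + M) = f n"
  shows "(\<Sum>n\<in>{a..<a + q * M}. f n) = real q * (\<Sum>n<M. f n)"
proof (induction q)
  case 0
  then show ?case by simp
next
  case (Suc q)
  have "(\<Sum>n\<in>{a..<a + Suc q * M}. f n)
      = (\<Sum>n\<in>{a..<a + q * M}. f n) + (\<Sum>n\<in>{a + q * M..<a + q * M + M}. f n)"
    using sum.atLeastLessThan_concat[of a "a + q * M" "a + q * M + M" f]
    by (simp add: algebra_simps)
  then show ?case
    using Suc sum_periodic_shift[of f M "a + q * M"] assms by (simp add: algebra_simps)
qed

lemma sum_periodic_le:
  fixes f :: "nat \<Rightarrow> real"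
  assumes per: "\<And>n. f (n + M) = f n" and le1: "\<And>n. f n \<le> 1"
    and M: "M > 0" and ab: "a \<le> b" and nn: "(\<Sum>n<M. f n) \<ge> 0"
  shows "(\<Sum>n\<in>{a..<b}. f n) \<le> (real b - real a) * ((\<Sum>n<M. f n) / real M) + real M"
proof -
  define q where "q = (b - a) div M"
  define c where "c = a + q * M"
  have qM: "q * M \<le> b - a" unfolding q_def by simp
  have cb: "c \<le> b" using qM ab unfolding c_def by linarith
  have "b - a < q * M + M"
    unfolding q_def using M by (metis add.commute dividend_less_div_times)
  hence bc: "b - c \<le> M" using ab unfolding c_def by linarith
  have "(\<Sum>n\<in>{a..<b}. f n) = (\<Sum>n\<in>{a..<c}. f n) + (\<Sum>n\<in>{c..<b}. f n)"
    using sum.atLeastLessThan_concat[of a c b f] cb unfolding c_def by simp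
  also have "(\<Sum>n\<in>{a..<c}. f n) = real q * (\<Sum>n<M. f n)"
    unfolding c_def using sum_periodic_blocks[of f M a q] per by simp
  also have "(\<Sum>n\<in>{c..<b}. f n) \<le> (\<Sum>n\<in>{c..<b}. 1)"
    by (intro sum_mono le1)
  also have "(\<Sum>n\<in>{c..<b}. 1) \<le> real M" using bc by simp
  also have "real q * (\<Sum>n<M. f n) \<le> (real b - real a) * ((\<Sum>n<M. f n) / real M)"
  proof -
    have "real (q * M) \<le> real (b - a)" using qM of_nat_le_iff by blast
    hence "real q * real M \<le> real b - real a" using ab by (simp add: of_nat_diff)
    hence "real q \<le> (real b - real a) / real M" using M by (simp add: field_simps)
    from mult_right_mono[OF this nn] show ?thesis by simp
  qed
  finally show ?thesis by simp
qed

lemma periodic_mod: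
  fixes f :: "nat \<Rightarrow> real"
  assumes "\<And>n. f (n + m) = f n"
  shows "f (n mod m) = f n"
proof -
  have *: "f (r + j * m) = f r" for r j
    by (induction j) (use assms in \<open>simp_all add: algebra_simps\<close>, metis add.commute add.left_commute)
  show ?thesis using *[of "n mod m" "n div m"] by simp
qed

lemma periodic_dvd:
  fixes f :: "nat \<Rightarrow> real"
  assumes "\<And>n. f (n + m) = f n" and "m dvd M"
  shows "f (n + M) = f n"
proof -
  have "f ((n + M) mod m) = f (n + M)" "f (n mod m) = f n"
    using assms(1) by (rule periodic_mod)+
  moreover have "(n + M) mod m = n mod m"
    using assms(2) by (auto simp: dvd_def)
  ultimately show ?thesis by simp
qed

text \<open>The Chinese remainder theorem: a uniformly distributed residue modulo \<open>a * b\<close> has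
  independent uniformly distributed residues modulo \<open>a\<close> and \<open>b\<close>.\<close>

lemma sum_periodic_mult_coprime:
  fixes f g :: "nat \<Rightarrow> real"
  assumes ab: "coprime a b" "a > 0" "b > 0"
    and f: "\<And>n. f (n + a) = f n" and g: "\<And>n. g (n + b) = g n"
  shows "(\<Sum>n<a * b. f n * g n) = (\<Sum>n<a. f n) * (\<Sum>n<b. g n)"
proof -
  let ?crt = "\<lambda>n. (n mod a, n mod b)"
  have inj: "inj_on ?crt {..<a * b}"
  proof (rule inj_onI)
    fix m n assume mn: "m \<in> {..<a * b}" "n \<in> {..<a * b}" "?crt m = ?crt n"
    have "[m = n] (mod a * b)"
      using mn(3) ab(1) by (intro coprime_cong_mult_nat) (auto simp: cong_def)
    thus "m = n" using mn(1,2) by (auto simp: cong_def)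
  qed
  have "?crt ` {..<a * b} = {..<a} \<times> {..<b}"
    using ab by (intro card_subset_eq) (auto simp: card_image[OF inj])
  hence bij: "bij_betw ?crt {..<a * b} ({..<a} \<times> {..<b})"
    using inj by (simp add: bij_betw_def)
  have "(\<Sum>n<a * b. f n * g n) = (\<Sum>n<a * b. f (n mod a) * g (n mod b))"
    by (simp add: periodic_mod[of f a, OF f] periodic_mod[of g b, OF g])
  also have "\<dots> = (\<Sum>(r, s)\<in>{..<a} \<times> {..<b}. f r * g s)"
    using sum.reindex_bij_betw[OF bij, of "\<lambda>(r, s). f r * g s"] by simp
  also have "\<dots> = (\<Sum>n<a. f n) * (\<Sum>n<b. g n)"
    by (simp add: sum_product sum.cartesian_product)
  finally show ?thesis .
qed

lemma sum_periodic_prod_coprime: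
  fixes f :: "'a \<Rightarrow> nat \<Rightarrow> real" and m :: "'a \<Rightarrow> nat"
  assumes "finite U"
    and "\<And>p. p \<in> U \<Longrightarrow> m p > 0"
    and "\<And>p q. p \<in> U \<Longrightarrow> q \<in> U \<Longrightarrow> p \<noteq> q \<Longrightarrow> coprime (m p) (m q)"
    and "\<And>p n. p \<in> U \<Longrightarrow> f p (n + m p) = f p n"
  shows "(\<Sum>n<prod m U. \<Prod>p\<in>U. f p n) = (\<Prod>p\<in>U. \<Sum>n<m p. f p n)"
  using assms
proof (induction U rule: finite_induct)
  case empty
  then show ?case by simp
next
  case (insert p U)
  have per: "(\<Prod>q\<in>U. f q (n + prod m U)) = (\<Prod>q\<in>U. f q n)" for n
  proof (rule prod.cong[OF refl])
    fix q assume q: "q \<in> U"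
    show "f q (n + prod m U) = f q n"
      by (rule periodic_dvd[of "f q" "m q"])
        (use insert.prems(3)[of q] q insert.hyps(1) dvd_prodI[of U q m] in auto)
  qed
  have "coprime (m p) (prod m U)"
    using insert.prems(2) insert.hyps by (intro prod_coprime_right) auto
  moreover have "prod m U > 0" using insert.prems(1) by (intro prod_pos) auto
  ultimately have "(\<Sum>n<m p * prod m U. f p n * (\<Prod>q\<in>U. f q n))
      = (\<Sum>n<m p. f p n) * (\<Sum>n<prod m U. \<Prod>q\<in>U. f q n)"
    using insert.prems per by (intro sum_periodic_mult_coprime) auto
  then show ?case using insert by simp
qed

section \<open>Selberg's sieve for prescribed residue classes\<close>

text \<open>The function that equals \<open>-1\<close> on the removed classes modulo \<open>m\<close> and \<open>c / (m - c)\<close> on the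
  others is the one with mean zero; its mean square is then \<open>c / (m - c)\<close> again.\<close>

lemma sieve_function_moments:
  fixes c m :: nat and bad :: "nat \<Rightarrow> bool"
  defines "h \<equiv> real c / (real m - real c)"
  defines "g \<equiv> \<lambda>n. if bad n then - 1 else h"
  assumes count: "card {n \<in> {..<m}. bad n} = c" and "c < m"
  shows "(\<Sum>n<m. g n) = 0" "(\<Sum>n<m. g n * g n) = real m * h"
proof -
  have fin: "finite {..<m}" by simp
  have split: "{..<m} \<inter> {n. bad n} = {n \<in> {..<m}. bad n}"
    "{..<m} \<inter> - {n. bad n} = {..<m} - {n \<in> {..<m}. bad n}" by auto
  have good: "real (card ({..<m} - {n \<in> {..<m}. bad n})) = real m - real c"
    using count \<open>c < m\<close> by (subst card_Diff_subset) (auto simp: of_nat_diff)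
  have pos: "real m - real c > 0" using \<open>c < m\<close> by simp
  have "(\<Sum>n<m. g n) = real c * (- 1) + (real m - real c) * h"
    unfolding g_def sum.If_cases[OF fin] split using count good by simp
  also have "\<dots> = 0" unfolding h_def using pos by (simp add: field_simps)
  finally show "(\<Sum>n<m. g n) = 0" .
  have "(\<Sum>n<m. g n * g n) = (\<Sum>n<m. if bad n then 1 else h * h)"
    unfolding g_def by (intro sum.cong) auto
  also have "\<dots> = real c + (real m - real c) * (h * h)"
    unfolding sum.If_cases[OF fin] split using count good by simp
  also have "\<dots> = real m * h"
  proof -
    have *: "(real m - real c) * h = real c" unfolding h_def using pos by simp
    have "(real m - real c) * (h * h) = real c * h" using * by (simp flip: mult.assoc)
    thus ?thesis using * by (simp add: algebra_simps)
  qed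
  finally show "(\<Sum>n<m. g n * g n) = real m * h" .
qed

text \<open>The functions \<open>g\<^sub>T\<close>, the products over \<open>p \<in> T\<close> of the functions of the previous lemma, are
  orthogonal over a full period because the moduli are coprime, and on a survivor of the sieve
  \<open>g\<^sub>T\<close> equals the product of the \<open>h p\<close>. Hence \<open>F = \<Sum>T. g\<^sub>T\<close> equals \<open>G\<close> on every survivor, and
  comparing with the sum of \<open>F\<^sup>2\<close> over the whole interval bounds the number of survivors. The
  coefficients of \<open>F\<close> are those that minimise Selberg's quadratic form; written in this orthogonal
  system they need no optimisation. The products
  \<open>g\<^sub>T * g\<^sub>T'\<close> have period at most \<open>Q\<^sup>2\<close> and, because \<open>2 * c \<le> m\<close> forces \<open>h \<le> 1\<close>, are bounded by
  \<open>1\<close>; so an incomplete last period costs at most \<open>Q\<^sup>2\<close> for each pair \<open>(T, T')\<close>.\<close>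

theorem selberg_sieve:
  fixes m c :: "'a \<Rightarrow> nat" and bad :: "'a \<Rightarrow> nat \<Rightarrow> bool" and \<T> :: "'a set set" and S :: "nat set"
  defines "h \<equiv> \<lambda>p. real (c p) / (real (m p) - real (c p))"
  defines "G \<equiv> \<Sum>T\<in>\<T>. \<Prod>p\<in>T. h p"
  assumes fin: "finite \<T>" "\<And>T. T \<in> \<T> \<Longrightarrow> finite T"
    and mpos: "\<And>p. p \<in> \<Union>\<T> \<Longrightarrow> m p > 0"
    and cop: "\<And>p q. p \<in> \<Union>\<T> \<Longrightarrow> q \<in> \<Union>\<T> \<Longrightarrow> p \<noteq> q \<Longrightarrow> coprime (m p) (m q)"
    and per: "\<And>p n. p \<in> \<Union>\<T> \<Longrightarrow> bad p (n + m p) = bad p n"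
    and count: "\<And>p. p \<in> \<Union>\<T> \<Longrightarrow> card {n \<in> {..<m p}. bad p n} = c p"
    and half: "\<And>p. p \<in> \<Union>\<T> \<Longrightarrow> 2 * c p \<le> m p"
    and Q: "\<And>T. T \<in> \<T> \<Longrightarrow> (\<Prod>p\<in>T. m p) \<le> Q"
    and ab: "a \<le> b" and S: "S \<subseteq> {a..<b}"
    and good: "\<And>n p. n \<in> S \<Longrightarrow> p \<in> \<Union>\<T> \<Longrightarrow> \<not> bad p n"
  shows "real (card S) * G\<^sup>2 \<le> (real b - real a) * G + (real (card \<T>) * real Q)\<^sup>2"
proof -
  define g where "g = (\<lambda>p n. if bad p n then - 1 else h p)"
  define H where "H = (\<lambda>T. \<Prod>p\<in>T. h p)"
  define f where "f = (\<lambda>T n. \<Prod>p\<in>T. g p n)"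
  have clt: "c p < m p" if "p \<in> \<Union>\<T>" for p
    using mpos[OF that] half[OF that] by linarith
  have h01: "0 \<le> h p" "h p \<le> 1" if "p \<in> \<Union>\<T>" for p
  proof -
    have "2 * real (c p) \<le> real (m p)" using half[OF that] by linarith
    thus "0 \<le> h p" "h p \<le> 1" using clt[OF that] unfolding h_def by (auto simp: field_simps)
  qed
  have gper: "g p (n + m p) = g p n" if "p \<in> \<Union>\<T>" for p n
    unfolding g_def using per[OF that] by simp
  have g0: "(\<Sum>n<m p. g p n) = 0" and g2: "(\<Sum>n<m p. g p n * g p n) = real (m p) * h p"
    if "p \<in> \<Union>\<T>" for p
    using sieve_function_moments[OF count[OF that] clt[OF that]] unfolding g_def h_def by auto
  have gabs: "\<bar>g p n\<bar> \<le> 1" if "p \<in> \<Union>\<T>" for p n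
    unfolding g_def using h01[OF that] by auto
  have fabs: "\<bar>f T n\<bar> \<le> 1" if "T \<in> \<T>" for T n
    unfolding f_def abs_prod using gabs that by (intro prod_le_1) auto

  have corr: "(\<Sum>n\<in>{a..<b}. f T n * f T' n)
      \<le> (real b - real a) * (if T = T' then H T else 0) + (real Q)\<^sup>2"
    if T: "T \<in> \<T>" and T': "T' \<in> \<T>" for T T'
  proof -
    define U where "U = T \<union> T'"
    define M where "M = prod m U"
    define \<psi> where "\<psi> = (\<lambda>p n. (if p \<in> T then g p n else 1) * (if p \<in> T' then g p n else 1))"
    have finU: "finite U" unfolding U_def using T T' fin by auto
    have sub: "p \<in> \<Union>\<T>" if "p \<in> U" for p using that T T' unfolding U_def by auto
    have ff: "f T n * f T' n = (\<Prod>p\<in>U. \<psi> p n)" for n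
    proof -
      have "f T n = (\<Prod>p\<in>U. if p \<in> T then g p n else 1)" unfolding f_def U_def
        using finU by (intro prod.mono_neutral_cong_left) (auto simp: U_def)
      moreover have "f T' n = (\<Prod>p\<in>U. if p \<in> T' then g p n else 1)" unfolding f_def U_def
        using finU by (intro prod.mono_neutral_cong_left) (auto simp: U_def)
      ultimately show ?thesis unfolding \<psi>_def by (simp add: prod.distrib)
    qed
    have \<psi>per: "\<psi> p (n + m p) = \<psi> p n" if "p \<in> U" for p n
      unfolding \<psi>_def using gper sub that by simp
    have Mper: "f T (n + M) * f T' (n + M) = f T n * f T' n" for n
      unfolding ff
    proof (rule prod.cong[OF refl])
      fix p assume p: "p \<in> U"
      show "\<psi> p (n + M) = \<psi> p n"
        by (rule periodic_dvd[of "\<psi> p" "m p"])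
          (use \<psi>per p finU dvd_prodI[of U p m] in \<open>auto simp: M_def\<close>)
    qed
    have Mpos: "M > 0" unfolding M_def using mpos sub by (intro prod_pos) auto
    have "(\<Sum>n<M. f T n * f T' n) = (\<Prod>p\<in>U. \<Sum>n<m p. \<psi> p n)"
      unfolding ff M_def using finU mpos cop sub \<psi>per
      by (intro sum_periodic_prod_coprime) auto
    also have "\<dots> = real M * (if T = T' then H T else 0)"
    proof (cases "T = T'")
      case True
      have "(\<Sum>n<m p. \<psi> p n) = real (m p) * h p" if "p \<in> U" for p
        using that True g2[OF sub[OF that]] unfolding \<psi>_def U_def by simp
      hence "(\<Prod>p\<in>U. \<Sum>n<m p. \<psi> p n) = (\<Prod>p\<in>U. real (m p) * h p)" by simp
      thus ?thesis using True unfolding M_def H_def U_def by (simp add: prod.distrib)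
    next
      case False
      then obtain p where p: "p \<in> U" "p \<in> T \<longleftrightarrow> p \<notin> T'" unfolding U_def by blast
      have "(\<Sum>n<m p. \<psi> p n) = (\<Sum>n<m p. g p n)"
        using p(2) unfolding \<psi>_def by (intro sum.cong) auto
      hence "(\<Sum>n<m p. \<psi> p n) = 0" using g0[OF sub[OF p(1)]] by simp
      hence "(\<Prod>p\<in>U. \<Sum>n<m p. \<psi> p n) = 0" using finU p(1) by (intro prod_zero) auto
      thus ?thesis using False by simp
    qed
    finally have full: "(\<Sum>n<M. f T n * f T' n) = real M * (if T = T' then H T else 0)" .
    have Hnn: "H T \<ge> 0" unfolding H_def using h01 T by (intro prod_nonneg) auto
    have le1: "f T n * f T' n \<le> 1" for n
    proof -
      have "\<bar>f T n\<bar> * \<bar>f T' n\<bar> \<le> 1 * 1" using fabs T T' by (intro mult_mono) auto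
      thus ?thesis by (simp flip: abs_mult)
    qed
    have "(\<Sum>n\<in>{a..<b}. f T n * f T' n)
        \<le> (real b - real a) * ((\<Sum>n<M. f T n * f T' n) / real M) + real M"
      using Mper le1 Mpos ab full Hnn by (intro sum_periodic_le) auto
    also have "(\<Sum>n<M. f T n * f T' n) / real M = (if T = T' then H T else 0)"
      unfolding full using Mpos by simp
    also have "real M \<le> (real Q)\<^sup>2"
    proof -
      have "M = prod m T * prod m (T' - T)"
        unfolding M_def U_def using finU
        by (subst prod.union_disjoint[symmetric]) (auto simp: U_def intro: prod.cong)
      also have "prod m (T' - T) \<le> prod m T'"
        using T' fin mpos
        by (intro dvd_imp_le prod_dvd_prod_subset prod_pos) (auto intro: fin)
      also have "prod m T * prod m T' \<le> Q * Q" using Q T T' by (intro mult_mono) auto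
      finally have "real M \<le> real (Q * Q)" by (simp add: of_nat_le_iff del: of_nat_mult)
      thus ?thesis by (simp add: power2_eq_square)
    qed
    finally show ?thesis by simp
  qed

  have F: "(\<Sum>T\<in>\<T>. f T n) = G" if "n \<in> S" for n
    unfolding G_def f_def g_def using good[OF that] by (intro sum.cong prod.cong) auto
  have "real (card S) * G\<^sup>2 = (\<Sum>n\<in>S. (\<Sum>T\<in>\<T>. f T n)\<^sup>2)" using F by simp
  also have "\<dots> \<le> (\<Sum>n\<in>{a..<b}. (\<Sum>T\<in>\<T>. f T n)\<^sup>2)"
    using S by (intro sum_mono2) auto
  also have "\<dots> = (\<Sum>n\<in>{a..<b}. \<Sum>T\<in>\<T>. \<Sum>T'\<in>\<T>. f T n * f T' n)"
    by (simp add: power2_eq_square sum_product)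
  also have "\<dots> = (\<Sum>T\<in>\<T>. \<Sum>n\<in>{a..<b}. \<Sum>T'\<in>\<T>. f T n * f T' n)"
    by (rule sum.swap)
  also have "\<dots> = (\<Sum>T\<in>\<T>. \<Sum>T'\<in>\<T>. \<Sum>n\<in>{a..<b}. f T n * f T' n)"
    by (intro sum.cong refl sum.swap)
  also have "\<dots> \<le> (\<Sum>T\<in>\<T>. \<Sum>T'\<in>\<T>. (real b - real a) * (if T = T' then H T else 0) + (real Q)\<^sup>2)"
    by (intro sum_mono corr)
  also have "\<dots> = (real b - real a) * G + (real (card \<T>) * real Q)\<^sup>2"
    using fin(1)
    by (simp add: sum.distrib G_def H_def power2_eq_square if_distrib[of "\<lambda>x. _ * x"]
        sum_distrib_left cong: if_cong)
  finally show ?thesis .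
qed

section \<open>Sums and products over primes\<close>

lemma sum_ln_prime_factors_le:
  fixes m :: nat
  assumes "m > 0"
  shows "(\<Sum>p\<in>prime_factors m. ln (real p)) \<le> ln (real m)"
proof -
  have pp: "prime p" if "p \<in> prime_factors m" for p using that by auto
  have pos: "0 < (\<Prod>p\<in>prime_factors m. p)"
    using pp by (intro prod_pos) (auto simp: prime_gt_0_nat)
  have "(\<Prod>p\<in>prime_factors m. p) dvd m"
  proof -
    have "(\<Prod>p\<in>prime_factors m. p) dvd (\<Prod>p\<in>prime_factors m. p ^ multiplicity p m)"
      by (intro prod_dvd_prod dvd_power) (auto simp: prime_factors_multiplicity)
    thus ?thesis using prime_factorization_nat[OF assms] by simp
  qed
  hence "(\<Prod>p\<in>prime_factors m. p) \<le> m" using assms by (rule dvd_imp_le)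
  hence le: "(\<Prod>p\<in>prime_factors m. real p) \<le> real m"
    by (simp flip: of_nat_prod)
  have "(\<Sum>p\<in>prime_factors m. ln (real p)) = ln (\<Prod>p\<in>prime_factors m. real p)"
    using pp by (intro ln_prod[symmetric]) (auto simp: prime_gt_0_nat)
  also have "\<dots> \<le> ln (real m)"
    using le pos by (intro ln_mono) (auto simp flip: of_nat_prod)
  finally show ?thesis .
qed

lemma card_multiples_le:
  fixes p W :: nat
  assumes "p > 0"
  shows "card {m \<in> {1..W}. p dvd m} = W div p"
proof -
  have "{m \<in> {1..W}. p dvd m} = (\<lambda>k. p * k) ` {1..W div p}"
  proof (intro equalityI subsetI)
    fix m assume "m \<in> {m \<in> {1..W}. p dvd m}"
    then obtain k where "m = p * k" "1 \<le> m" "m \<le> W" by auto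
    moreover from this have "k \<le> W div p"
      using assms by (simp add: less_eq_div_iff_mult_less_eq mult.commute)
    moreover have "k \<ge> 1" using \<open>m = p * k\<close> \<open>1 \<le> m\<close> by (cases k) auto
    ultimately show "m \<in> (\<lambda>k. p * k) ` {1..W div p}" by auto
  next
    fix m assume "m \<in> (\<lambda>k. p * k) ` {1..W div p}"
    then obtain k where "k \<in> {1..W div p}" "m = p * k" by (rule imageE)
    thus "m \<in> {m \<in> {1..W}. p dvd m}"
      using assms by (auto simp: less_eq_div_iff_mult_less_eq mult.commute)
  qed
  moreover have "inj_on (\<lambda>k. p * k) {1..W div p}" using assms by (auto simp: inj_on_def)
  ultimately show ?thesis by (simp add: card_image)
qed

text \<open>A weak form of Mertens' first theorem. Counting prime divisors of \<open>1, \<dots>, W\<close> gives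
  \<open>\<Sum>p. (W div p) * ln p \<le> ln (W!)\<close>; replacing \<open>W div p\<close> by the lower bound \<open>W / (2 * p)\<close> costs a
  factor \<open>2\<close> but avoids any Chebyshev estimate.\<close>

lemma sum_ln_over_primes_le:
  fixes W :: nat
  assumes "W \<ge> 1"
  shows "(\<Sum>p | prime p \<and> p \<le> W. ln (real p) / real p) \<le> 2 * ln (real W)"
proof -
  let ?P = "{p. prime p \<and> p \<le> W}"
  have finP: "finite ?P" by simp
  have ln_nn: "ln (real p) \<ge> 0" if "p \<in> ?P" for p
    using that prime_ge_1_nat[of p] by (intro ln_ge_zero) auto
  have "real W / 2 * (\<Sum>p\<in>?P. ln (real p) / real p)
      = (\<Sum>p\<in>?P. (real W / (2 * real p)) * ln (real p))"
    by (simp add: sum_distrib_left)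
  also have "\<dots> \<le> (\<Sum>p\<in>?P. real (W div p) * ln (real p))"
  proof (rule sum_mono)
    fix p assume p: "p \<in> ?P"
    hence p0: "p > 0" by (auto simp: prime_gt_0_nat)
    have "W div p \<ge> 1" using p p0 by (simp add: Suc_le_eq div_greater_zero_iff)
    moreover have "W < p * (W div p) + p"
      using p0 by (metis add.commute dividend_less_times_div)
    ultimately have "W \<le> 2 * (p * (W div p))"
      using mult_le_mono2[of 1 "W div p" p] by linarith
    hence "real W \<le> 2 * (real p * real (W div p))"
      by (metis of_nat_le_iff of_nat_mult of_nat_numeral)
    hence "real W / (2 * real p) \<le> real (W div p)" using p0 by (simp add: field_simps)
    thus "(real W / (2 * real p)) * ln (real p) \<le> real (W div p) * ln (real p)"
      using ln_nn[OF p] by (rule mult_right_mono)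
  qed
  also have "\<dots> = (\<Sum>p\<in>?P. \<Sum>m\<in>{1..W}. if p dvd m then ln (real p) else 0)"
  proof (rule sum.cong[OF refl])
    fix p assume "p \<in> ?P"
    hence "p > 0" by (auto simp: prime_gt_0_nat)
    have "(\<Sum>m\<in>{1..W}. if p dvd m then ln (real p) else 0)
        = (\<Sum>m\<in>{m \<in> {1..W}. p dvd m}. ln (real p))"
      by (subst sum.inter_filter) auto
    thus "real (W div p) * ln (real p) = (\<Sum>m\<in>{1..W}. if p dvd m then ln (real p) else 0)"
      using card_multiples_le[OF \<open>p > 0\<close>, of W] by simp
  qed
  also have "\<dots> = (\<Sum>m\<in>{1..W}. \<Sum>p\<in>?P. if p dvd m then ln (real p) else 0)"
    by (rule sum.swap)
  also have "\<dots> \<le> (\<Sum>m\<in>{1..W}. ln (real W))"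
  proof (rule sum_mono)
    fix m assume m: "m \<in> {1..W}"
    have "(\<Sum>p\<in>?P. if p dvd m then ln (real p) else 0) = (\<Sum>p\<in>{p \<in> ?P. p dvd m}. ln (real p))"
      using finP by (subst sum.inter_filter) auto
    also have "{p \<in> ?P. p dvd m} = prime_factors m"
      using m by (auto simp: prime_factors_dvd dest: dvd_imp_le)
    also have "(\<Sum>p\<in>prime_factors m. ln (real p)) \<le> ln (real m)"
      using m by (intro sum_ln_prime_factors_le) auto
    also have "\<dots> \<le> ln (real W)" using m by simp
    finally show "(\<Sum>p\<in>?P. if p dvd m then ln (real p) else 0) \<le> ln (real W)" .
  qed
  also have "\<dots> = real W * ln (real W)" by simp
  finally show ?thesis using assms by (simp add: field_simps)
qed

text \<open>The integral comparison \<open>\<zeta>(1 + t) \<le> 1 + 1 / t\<close> in telescoping form: convexity of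
  \<open>u \<mapsto> u powr - t\<close> bounds each term by a difference of consecutive values divided by \<open>t\<close>.\<close>

lemma sum_powr_le_zeta_bound:
  fixes t :: real
  assumes "t > 0"
  shows "(\<Sum>n = 1..N. real n powr - (1 + t)) \<le> 1 + 1 / t"
proof -
  have step: "real (Suc n) powr - (1 + t) \<le> (real n powr - t - real (Suc n) powr - t) / t"
    if "n \<ge> 1" for n
  proof -
    define u where "u = real n / real (Suc n)"
    have u: "u > 0" using that unfolding u_def by simp
    have "1 + t * (1 - u) \<le> exp (t * (1 - u))" by (rule exp_ge_add_one_self)
    also have "\<dots> \<le> exp (- t * ln u)"
      using ln_le_minus_one[OF u] assms mult_left_mono[of "ln u" "u - 1" t]
      by (simp add: algebra_simps)
    also have "\<dots> = u powr - t" using u by (simp add: powr_def)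
    also have "\<dots> = real n powr - t / real (Suc n) powr - t"
      unfolding u_def by (simp add: powr_divide)
    finally have "(1 + t * (1 - u)) * real (Suc n) powr - t \<le> real n powr - t"
      by (simp add: field_simps)
    moreover have "1 - u = 1 / real (Suc n)" unfolding u_def by (simp add: field_simps)
    moreover have "real (Suc n) powr - (1 + t) = real (Suc n) powr - t / real (Suc n)"
      using powr_diff[of "real (Suc n)" "- t" 1] minus_add_distrib[of t 1]
      by (simp add: add.commute[of 1 t])
    ultimately have "t * real (Suc n) powr - (1 + t) \<le> real n powr - t - real (Suc n) powr - t"
      by (simp add: algebra_simps)
    thus ?thesis using assms by (simp add: pos_le_divide_eq mult.commute)
  qed
  have bound: "(\<Sum>n = 1..Suc N. real n powr - (1 + t)) \<le> 1 + (1 - real (Suc N) powr - t) / t" for N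
  proof (induction N)
    case 0
    then show ?case by simp
  next
    case (Suc N)
    have "(\<Sum>n = 1..Suc (Suc N). real n powr - (1 + t))
        \<le> (1 + (1 - real (Suc N) powr - t) / t)
          + (real (Suc N) powr - t - real (Suc (Suc N)) powr - t) / t"
      using Suc step[of "Suc N"] by simp
    also have "\<dots> = 1 + (1 - real (Suc (Suc N)) powr - t) / t"
      using assms by (simp add: field_simps)
    finally show ?case .
  qed
  have lim: "1 + (1 - real (Suc M) powr - t) / t \<le> 1 + 1 / t" for M
    using assms by (simp add: divide_right_mono)
  show ?thesis
  proof (cases N)
    case 0
    then show ?thesis using assms by simp
  next
    case (Suc M)
    then show ?thesis using order_trans[OF bound[of M] lim[of M]] by blast
  qed
qed

lemma prime_factors_prod_primes:
  assumes "finite T" "\<And>p. p \<in> T \<Longrightarrow> prime (p :: nat)"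
  shows "prime_factors (\<Prod>T) = T"
proof -
  have "prime_factors (prod (\<lambda>p. p) T) = (\<Union>p\<in>T. prime_factors p)"
    using assms by (subst prime_factors_prod) (auto dest: prime_gt_0_nat)
  also have "\<dots> = (\<Union>p\<in>T. {p})" using assms(2) by (intro SUP_cong) (auto simp: prime_prime_factors)
  finally show ?thesis by simp
qed

text \<open>Mertens' product bound up to a constant. Shifting the exponent from \<open>1\<close> to
  \<open>s = 1 + 1 / ln W\<close> changes the product by a bounded factor, by the estimate for
  \<open>\<Sum>p. ln p / p\<close>, and the shifted product is dominated by \<open>\<zeta>(s) \<le> 1 + 1 / (s - 1)\<close>.\<close>

lemma prod_one_plus_inverse_primes_le:
  fixes W :: nat
  assumes "W \<ge> 2"
  shows "(\<Prod>p | prime p \<and> p \<le> W. 1 + 1 / real p) \<le> exp 2 * (1 + ln (real W))"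
proof -
  let ?P = "{p. prime p \<and> p \<le> W}"
  define t where "t = 1 / ln (real W)"
  have lnW: "ln (real W) > 0" using assms by simp
  have t: "t > 0" unfolding t_def using lnW by simp
  have p0: "p > 0" if "p \<in> ?P" for p using that by (auto simp: prime_gt_0_nat)
  have finP: "finite ?P" by simp
  have factor: "1 + 1 / real p \<le> (1 + real p powr - (1 + t)) * exp (t * (ln (real p) / real p))"
    if p: "p \<in> ?P" for p
  proof -
    have pos: "real p > 0" using p0[OF p] by simp
    have "1 - t * ln (real p) \<le> real p powr - t"
      using exp_ge_add_one_self[of "- t * ln (real p)"] pos by (simp add: powr_def)
    hence "(1 - t * ln (real p)) / real p \<le> real p powr - t / real p"
      using pos by (intro divide_right_mono) auto
    also have "\<dots> = real p powr - (1 + t)"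
      using powr_diff[of "real p" "- t" 1] pos minus_add_distrib[of t 1]
      by (simp add: add.commute[of 1 t])
    finally have 1: "1 / real p \<le> real p powr - (1 + t) + t * (ln (real p) / real p)"
      by (simp add: diff_divide_distrib)
    define d where "d = t * (ln (real p) / real p)"
    have "d \<ge> 0" unfolding d_def using t pos p0[OF p] by (auto intro!: mult_nonneg_nonneg divide_nonneg_nonneg ln_ge_zero)
    define q where "q = real p powr - (1 + t)"
    have "q * d \<ge> 0" unfolding q_def using \<open>d \<ge> 0\<close> by simp
    moreover have "(1 + q) * (1 + d) = 1 + q + d + q * d" by (simp add: algebra_simps)
    ultimately have "1 + 1 / real p \<le> (1 + real p powr - (1 + t)) * (1 + d)"
      using 1 unfolding d_def[symmetric] q_def[symmetric] by linarith
    also have "\<dots> \<le> (1 + real p powr - (1 + t)) * exp d"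
      by (intro mult_left_mono exp_ge_add_one_self add_nonneg_nonneg) auto
    finally show ?thesis unfolding d_def .
  qed
  have "(\<Prod>p\<in>?P. 1 + 1 / real p)
      \<le> (\<Prod>p\<in>?P. (1 + real p powr - (1 + t)) * exp (t * (ln (real p) / real p)))"
    by (intro prod_mono conjI factor) auto
  also have "\<dots> = (\<Prod>p\<in>?P. 1 + real p powr - (1 + t)) * exp (t * (\<Sum>p\<in>?P. ln (real p) / real p))"
    using finP by (simp add: prod.distrib exp_sum sum_distrib_left)
  also have "\<dots> \<le> (1 + ln (real W)) * exp 2"
  proof (rule mult_mono)
    have "t * (\<Sum>p\<in>?P. ln (real p) / real p) \<le> t * (2 * ln (real W))"
      using sum_ln_over_primes_le[of W] assms t by (intro mult_left_mono) auto
    also have "\<dots> = 2" unfolding t_def using lnW by simp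
    finally show "exp (t * (\<Sum>p\<in>?P. ln (real p) / real p)) \<le> exp 2" by simp
    \<comment> \<open>Expanding the product gives a sum over squarefree integers, hence part of the zeta sum.\<close>
    have sub: "finite T \<and> (\<forall>p\<in>T. prime p)" if "T \<in> Pow ?P" for T
      using that finite_subset[OF _ finP, of T] by auto
    have inj: "inj_on Prod (Pow ?P)"
    proof (rule inj_onI)
      fix T T' assume "T \<in> Pow ?P" "T' \<in> Pow ?P" "\<Prod>T = \<Prod>T'"
      thus "T = T'" using sub prime_factors_prod_primes by metis
    qed
    have "(\<Prod>p\<in>?P. 1 + real p powr - (1 + t)) = (\<Prod>p\<in>?P. real p powr - (1 + t) + 1)"
      by (simp add: add.commute)
    also have "\<dots> = (\<Sum>T\<in>Pow ?P. \<Prod>p\<in>T. real p powr - (1 + t))"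
      using prod_add[OF finP, of "\<lambda>p. real p powr - (1 + t)" "\<lambda>_. 1"] by simp
    also have "\<dots> = (\<Sum>T\<in>Pow ?P. real (\<Prod>T) powr - (1 + t))"
      by (simp add: prod_powr_distrib)
    also have "\<dots> = (\<Sum>n\<in>Prod ` Pow ?P. real n powr - (1 + t))"
      using inj by (simp add: sum.reindex)
    also have "\<dots> \<le> (\<Sum>n = 1..\<Prod>?P. real n powr - (1 + t))"
    proof (rule sum_mono2)
      show "Prod ` Pow ?P \<subseteq> {1..\<Prod>?P}"
      proof
        fix n assume "n \<in> Prod ` Pow ?P"
        then obtain T where T: "T \<subseteq> ?P" "n = \<Prod>T" by auto
        have "\<Prod>T dvd \<Prod>?P" using T(1) finP prod_dvd_prod_subset by blast
        moreover have "0 < \<Prod>?P" using p0 by (intro prod_pos) auto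
        moreover have "0 < \<Prod>T" using p0 T(1) by (intro prod_pos) auto
        ultimately show "n \<in> {1..\<Prod>?P}" using T(2) dvd_imp_le by (auto simp: Suc_le_eq)
      qed
    qed auto
    also have "\<dots> \<le> 1 + 1 / t" by (rule sum_powr_le_zeta_bound[OF t])
    also have "\<dots> = 1 + ln (real W)" unfolding t_def by simp
    finally show "(\<Prod>p\<in>?P. 1 + real p powr - (1 + t)) \<le> 1 + ln (real W)" .
  qed (use lnW in auto)
  finally show ?thesis by (simp add: mult.commute)
qed

section \<open>The sieve density of the exact divisors\<close>

lemma card_exact_multiples:
  fixes p :: nat
  assumes "p > 0"
  shows "card {n \<in> {..<p\<^sup>2}. p dvd n \<and> \<not> p\<^sup>2 dvd n} = p - 1"
proof -
  have "{n \<in> {..<p\<^sup>2}. p dvd n \<and> \<not> p\<^sup>2 dvd n} = (\<lambda>k. p * k) ` {1..<p}"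
  proof (intro equalityI subsetI)
    fix n assume n: "n \<in> {n \<in> {..<p\<^sup>2}. p dvd n \<and> \<not> p\<^sup>2 dvd n}"
    then obtain k where k: "n = p * k" by auto
    have "k < p" using n k by (simp add: power2_eq_square)
    moreover have "k \<noteq> 0" using n k by (auto intro: Nat.gr0I)
    ultimately show "n \<in> (\<lambda>k. p * k) ` {1..<p}" using k by auto
  next
    fix n assume "n \<in> (\<lambda>k. p * k) ` {1..<p}"
    then obtain k where "k \<in> {1..<p}" "n = p * k" by (rule imageE)
    thus "n \<in> {n \<in> {..<p\<^sup>2}. p dvd n \<and> \<not> p\<^sup>2 dvd n}"
      using assms by (auto simp: power2_eq_square dest: dvd_imp_le)
  qed
  moreover have "inj_on (\<lambda>k. p * k) {1..<p}" using assms by (auto simp: inj_on_def)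
  ultimately show ?thesis by (simp add: card_image)
qed

lemma sum_inverse_consecutive_le:
  assumes "finite X" "X \<subseteq> {2..}"
  shows "(\<Sum>n\<in>X. 1 / (real n * (real n - 1))) \<le> 1"
proof -
  have tele: "(\<Sum>n = 2..N + 1. 1 / (real n * (real n - 1))) = 1 - 1 / real (N + 1)" for N
  proof (induction N)
    case (Suc N)
    have "1 / ((real N + 2) * (real N + 1)) = 1 / (real N + 1) - 1 / (real N + 2)"
      by (simp add: divide_simps)
    then show ?case using Suc by (simp add: add.commute)
  qed simp
  obtain N where N: "X \<subseteq> {..N}" using assms(1) finite_nat_iff_bounded_le by auto
  have "(\<Sum>n\<in>X. 1 / (real n * (real n - 1))) \<le> (\<Sum>n = 2..N + 1. 1 / (real n * (real n - 1)))"
    using N assms(2) by (intro sum_mono2) (auto simp: subset_iff le_SucI)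
  also have "\<dots> \<le> 1" unfolding tele by simp
  finally show ?thesis .
qed

lemma sum_inverse_squares_le: "(\<Sum>k = 1..N. 1 / (real k)\<^sup>2) \<le> 2"
proof (cases N)
  case (Suc M)
  have "(\<Sum>k = 1..N. 1 / (real k)\<^sup>2) = 1 + (\<Sum>k = 2..N. 1 / (real k)\<^sup>2)"
    using Suc sum.atLeast_Suc_atMost[of 1 N "\<lambda>k. 1 / (real k)\<^sup>2"] by (simp add: numeral_2_eq_2)
  also have "(\<Sum>k = 2..N. 1 / (real k)\<^sup>2) \<le> (\<Sum>k = 2..N. 1 / (real k * (real k - 1)))"
    by (intro sum_mono frac_le) (auto simp: power2_eq_square)
  also have "\<dots> \<le> 1" by (rule sum_inverse_consecutive_le) auto
  finally show ?thesis by simp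
qed simp

text \<open>The sets of prime divisors of the squarefree integers up to \<open>N\<close> all of whose prime factors
  exceed \<open>W\<close>. The bound \<open>p \<le> N\<close> excludes infinite sets, whose product is \<open>1\<close> by convention.\<close>

definition rough_prime_sets :: "nat \<Rightarrow> nat \<Rightarrow> nat set set" where
  "rough_prime_sets W N = {T. T \<subseteq> {p. prime p \<and> W < p \<and> p \<le> N} \<and> \<Prod>T \<le> N}"

lemma finite_rough_prime_sets: "finite (rough_prime_sets W N)"
  by (rule finite_subset[of _ "Pow {..N}"]) (auto simp: rough_prime_sets_def)

lemma rough_prime_setsD:
  assumes "T \<in> rough_prime_sets W N"
  shows "finite T" "\<And>p. p \<in> T \<Longrightarrow> prime p" "\<And>p. p \<in> T \<Longrightarrow> W < p" "\<Prod>T \<le> N"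
proof -
  have "T \<subseteq> {..N}" using assms by (auto simp: rough_prime_sets_def)
  thus "finite T" by (rule finite_subset) simp
qed (use assms in \<open>auto simp: rough_prime_sets_def\<close>)

lemma card_rough_prime_sets_le: "card (rough_prime_sets W N) \<le> N"
proof -
  have "inj_on Prod (rough_prime_sets W N)"
  proof (rule inj_onI)
    fix T T' assume *: "T \<in> rough_prime_sets W N" "T' \<in> rough_prime_sets W N" "\<Prod>T = \<Prod>T'"
    have "prime_factors (\<Prod>T) = T" "prime_factors (\<Prod>T') = T'"
      using rough_prime_setsD(1,2)[OF *(1)] rough_prime_setsD(1,2)[OF *(2)]
      by (auto simp: prime_factors_prod_primes)
    thus "T = T'" using *(3) by metis
  qed
  moreover have "Prod ` rough_prime_sets W N \<subseteq> {1..N}"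
  proof
    fix n assume "n \<in> Prod ` rough_prime_sets W N"
    then obtain T where T: "T \<in> rough_prime_sets W N" "n = \<Prod>T" by (elim imageE)
    have "\<Prod>T > 0" using rough_prime_setsD(2)[OF T(1)] by (intro prod_pos) (auto dest: prime_gt_0_nat)
    thus "n \<in> {1..N}" using T rough_prime_setsD(4)[OF T(1)] by simp
  qed
  ultimately have "card (rough_prime_sets W N) \<le> card {1..N}" by (intro card_inj_on_le) auto
  thus ?thesis by simp
qed

lemma squarefree_eq_prod_prime_factors:
  fixes a :: nat
  assumes "squarefree a"
  shows "a = \<Prod>(prime_factors a)"
proof -
  have a: "a > 0" using assms by (cases a) auto
  have "multiplicity p a = 1" if "p \<in> prime_factors a" for p
  proof -
    have "multiplicity p a \<le> 1" using that assms a squarefree_factorial_semiring''[of a] by auto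
    moreover have "multiplicity p a > 0" using that by (simp add: prime_factors_multiplicity)
    ultimately show ?thesis by simp
  qed
  hence "(\<Prod>p\<in>prime_factors a. p ^ multiplicity p a) = \<Prod>(prime_factors a)" by simp
  thus ?thesis using prime_factorization_nat[OF a] by simp
qed

text \<open>Every positive \<open>m \<le> N\<close> is a square times a product of distinct primes \<open>\<le> W\<close> times a product of
  distinct primes \<open>> W\<close>, so the harmonic sum is at most the product of the corresponding three
  sums. The first is bounded and the second is \<open>O(ln W)\<close>, so the third is at least of order
  \<open>ln N / ln W\<close>.\<close>

lemma ln_le_rough_sum:
  "ln (real N + 1) \<le> 2 * (\<Prod>p | prime p \<and> p \<le> W. 1 + 1 / real p)
      * (\<Sum>T\<in>rough_prime_sets W N. 1 / real (\<Prod>T))"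
proof -
  let ?P = "{p. prime p \<and> p \<le> W}"
  let ?I = "{1..N} \<times> Pow ?P \<times> rough_prime_sets W N"
  let ?v = "\<lambda>(k, S, T). k\<^sup>2 * \<Prod>S * \<Prod>T"
  have finP: "finite ?P" by simp
  have "ln (real N + 1) \<le> (\<Sum>m = 1..N. 1 / real m)"
    using ln_le_harm[of N] by (simp add: harm_def inverse_eq_divide)
  also have "\<dots> \<le> (\<Sum>z\<in>?I. 1 / real (?v z))"
  proof (rule sum_le_included[where i = ?v])
    show "\<forall>m\<in>{1..N}. \<exists>z\<in>?I. ?v z = m \<and> 1 / real m \<le> 1 / real (?v z)"
    proof
      fix m assume m: "m \<in> {1..N}"
      define k where "k = square_part m"
      define a where "a = squarefree_part m"
      define S where "S = {p \<in> prime_factors a. p \<le> W}"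
      define T where "T = {p \<in> prime_factors a. W < p}"
      have mka: "m = a * k\<^sup>2" unfolding k_def a_def by (rule squarefree_decompose)
      have a: "a = \<Prod>(prime_factors a)"
        unfolding a_def by (rule squarefree_eq_prod_prime_factors) (rule squarefree_squarefree_part)
      have ST: "prime_factors a = S \<union> T" "S \<inter> T = {}" unfolding S_def T_def by auto
      have "a = \<Prod>S * \<Prod>T"
        using a ST by (metis finite_set_mset finite_Un prod.union_disjoint)
      hence v: "?v (k, S, T) = m" using mka by simp
      have m0: "m > 0" "m \<le> N" using m by auto
      have "k > 0" using mka m0 by (cases k) auto
      have "k \<le> k\<^sup>2" by (simp add: power2_eq_square)
      also have "\<dots> \<le> m" using mka m0 by (intro dvd_imp_le) auto
      finally have "k \<in> {1..N}" using \<open>k > 0\<close> m0 by simp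
      moreover have "S \<in> Pow ?P" unfolding S_def by auto
      moreover have "T \<in> rough_prime_sets W N"
      proof -
        have "\<Prod>T dvd m" using v by (auto simp: dvd_def intro!: exI[of _ "k\<^sup>2 * \<Prod>S"])
        hence "\<Prod>T \<le> N" using m0 dvd_imp_le le_trans by blast
        moreover have "p \<le> N" if "p \<in> T" for p
        proof -
          have "p dvd m" using that mka unfolding T_def by (auto simp: prime_factors_dvd)
          thus ?thesis using m0 dvd_imp_le le_trans by blast
        qed
        ultimately show ?thesis unfolding rough_prime_sets_def T_def by auto
      qed
      ultimately show "\<exists>z\<in>?I. ?v z = m \<and> 1 / real m \<le> 1 / real (?v z)"
        using v by (intro bexI[of _ "(k, S, T)"]) auto
    qed
  qed (auto simp: finite_rough_prime_sets)
  also have "\<dots> = (\<Sum>(k, S, T)\<in>?I. 1 / (real k)\<^sup>2 * (1 / real (\<Prod>S) * (1 / real (\<Prod>T))))"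
    by (intro sum.cong) auto
  also have "\<dots> = (\<Sum>k = 1..N. 1 / (real k)\<^sup>2)
      * ((\<Sum>S\<in>Pow ?P. 1 / real (\<Prod>S)) * (\<Sum>T\<in>rough_prime_sets W N. 1 / real (\<Prod>T)))"
    unfolding sum_product unfolding sum_distrib_left sum.cartesian_product[symmetric] ..
  also have "(\<Sum>S\<in>Pow ?P. 1 / real (\<Prod>S)) = (\<Prod>p\<in>?P. 1 + 1 / real p)"
    using prod_add[OF finP, of "\<lambda>p. 1 / real p" "\<lambda>_. 1"] by (simp add: prod_dividef add.commute)
  also have "(\<Sum>k = 1..N. 1 / (real k)\<^sup>2)
        * ((\<Prod>p\<in>?P. 1 + 1 / real p) * (\<Sum>T\<in>rough_prime_sets W N. 1 / real (\<Prod>T)))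
      \<le> 2 * ((\<Prod>p\<in>?P. 1 + 1 / real p) * (\<Sum>T\<in>rough_prime_sets W N. 1 / real (\<Prod>T)))"
    by (intro mult_right_mono sum_inverse_squares_le mult_nonneg_nonneg prod_nonneg sum_nonneg)
      (auto intro!: prod_nonneg)
  finally show ?thesis by (simp add: mult.assoc)
qed

text \<open>The factor on the right is the weight \<open>c / (m - c)\<close> for \<open>m = p\<^sup>2\<close> and \<open>c = p - 1\<close>: the removed
  classes modulo \<open>p\<^sup>2\<close> are those of the multiples of \<open>p\<close> other than \<open>0\<close>. This weight is \<open>1 / p\<close>
  divided by \<open>1 + 1 / (p * (p - 1))\<close>, and the product of these correction factors is bounded because
  \<open>\<Sum>n. 1 / (n * (n - 1))\<close> converges.\<close>

lemma inverse_prod_le_sieve_weight: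
  assumes "finite T" "\<And>p. p \<in> T \<Longrightarrow> p \<ge> 2"
  shows "1 / real (\<Prod>T) \<le> exp 1 * (\<Prod>p\<in>T. real (p - 1) / (real (p\<^sup>2) - real (p - 1)))"
proof -
  let ?h = "\<lambda>p. real (p - 1) / (real (p\<^sup>2) - real (p - 1))"
  have h: "1 / real p \<le> exp (1 / (real p * (real p - 1))) * ?h p" "0 \<le> ?h p" if "p \<in> T" for p
  proof -
    define r where "r = real p - 1"
    have r: "r \<ge> 1" "real (p - 1) = r" "real p = r + 1"
      using assms(2)[OF that] unfolding r_def by (auto simp: of_nat_diff)
    have den: "(r + 1)\<^sup>2 - r > 0" using r by (simp add: power2_eq_square algebra_simps add_pos_nonneg)
    have "1 / (r + 1) = (1 + 1 / ((r + 1) * r)) * (r / ((r + 1)\<^sup>2 - r))"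
      using r den by (simp add: divide_simps) (simp add: power2_eq_square algebra_simps)
    also have "\<dots> \<le> exp (1 / ((r + 1) * r)) * (r / ((r + 1)\<^sup>2 - r))"
      using r den by (intro mult_right_mono exp_ge_add_one_self) auto
    finally show "1 / real p \<le> exp (1 / (real p * (real p - 1))) * ?h p" using r by simp
    show "0 \<le> ?h p" using r den by simp
  qed
  have "1 / real (\<Prod>T) = (\<Prod>p\<in>T. 1 / real p)" by (simp add: prod_dividef)
  also have "\<dots> \<le> (\<Prod>p\<in>T. exp (1 / (real p * (real p - 1))) * ?h p)"
    using h by (intro prod_mono) auto
  also have "\<dots> = exp (\<Sum>p\<in>T. 1 / (real p * (real p - 1))) * (\<Prod>p\<in>T. ?h p)"
    using assms(1) by (simp only: prod.distrib exp_sum)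
  also have "\<dots> \<le> exp 1 * (\<Prod>p\<in>T. ?h p)"
    using sum_inverse_consecutive_le[OF assms(1)] assms(2) h(2)
    by (intro mult_right_mono prod_nonneg) auto
  finally show ?thesis .
qed

section \<open>Integers whose simple prime divisors are small\<close>

text \<open>Sieving by \<open>p\<^sup>2\<close> for the primes \<open>p > w\<close> gives a main term \<open>2 * y / G\<close> with \<open>G\<close> at
  least of order \<open>ln y / ln w\<close>. The sum \<open>G\<close> runs over squarefree \<open>d \<le> D\<close>, so there are at most
  \<open>D\<close> sieve functions, each of period \<open>d\<^sup>2 \<le> D\<^sup>2\<close>, and the error term is at most \<open>D ^ 6\<close>.\<close>

lemma card_exact_divisors_small_le:
  fixes w x y :: real
  assumes w: "w \<ge> 2" and y: "y \<ge> 2" and x: "x \<ge> 0"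
  shows "real (card {n :: nat. x < real n \<and> real n \<le> x + y \<and>
            (\<forall>p. prime p \<longrightarrow> p dvd n \<longrightarrow> \<not> p\<^sup>2 dvd n \<longrightarrow> real p \<le> w)})
          \<le> 144 * exp 3 * (y * ln w / ln y) + y powr (1 / 2)"
proof -
  define S where "S = {n :: nat. x < real n \<and> real n \<le> x + y \<and>
            (\<forall>p. prime p \<longrightarrow> p dvd n \<longrightarrow> \<not> p\<^sup>2 dvd n \<longrightarrow> real p \<le> w)}"
  define W where "W = nat \<lfloor>w\<rfloor>"
  \<comment> \<open>Any exponent below \<open>1 / 6\<close> keeps the error \<open>D ^ 6\<close> below a fixed power of \<open>y\<close> less than 1.\<close>
  define D where "D = y powr (1 / 12)"
  define N where "N = nat \<lfloor>D\<rfloor>"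
  define \<T> where "\<T> = rough_prime_sets W N"
  define h where "h = (\<lambda>p. real (p - 1) / (real (p\<^sup>2) - real (p - 1)))"
  define G where "G = (\<Sum>T\<in>\<T>. \<Prod>p\<in>T. h p)"
  define a where "a = nat \<lfloor>x\<rfloor> + 1"
  define b where "b = nat \<lfloor>x + y\<rfloor> + 1"

  have W2: "W \<ge> 2" unfolding W_def using w by (simp add: le_nat_iff le_floor_iff)
  have Ww: "real W \<le> w" unfolding W_def using w by (simp add: of_nat_nat)
  have wW: "w < real p" if "W < p" for p
    using that w unfolding W_def by (metis floor_less_iff nat_less_iff of_int_of_nat_eq zero_le_floor order.trans zero_le_numeral)
  have D1: "D \<ge> 1" unfolding D_def using y by (simp add: ge_one_powr_ge_zero)
  have N1: "N \<ge> 1" unfolding N_def using D1 by (simp add: le_nat_iff le_floor_iff)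
  have ND: "real N \<le> D" "D < real N + 1" unfolding N_def using D1 by (auto simp: of_nat_nat)
  have ab: "a \<le> b" unfolding a_def b_def using x y by (simp add: nat_mono floor_mono)
  have len: "real b - real a \<le> 2 * y"
    unfolding a_def b_def using x y by (simp add: of_nat_nat) linarith
  have Sab: "S \<subseteq> {a..<b}"
  proof
    fix n assume "n \<in> S"
    hence n: "x < real n" "real n \<le> x + y" unfolding S_def by auto
    have "\<lfloor>x\<rfloor> < int n" using n(1) by (simp add: floor_less_iff)
    moreover have "int n \<le> \<lfloor>x + y\<rfloor>" using n(2) by (simp add: le_floor_iff)
    ultimately show "n \<in> {a..<b}" unfolding a_def b_def using x by (auto simp: Suc_le_eq nat_less_iff)
  qed

  have TD: "finite T" "\<And>p. p \<in> T \<Longrightarrow> prime p" "\<And>p. p \<in> T \<Longrightarrow> W < p" "\<Prod>T \<le> N"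
    if "T \<in> \<T>" for T using rough_prime_setsD[of T W N] that unfolding \<T>_def by auto
  have sieve: "real (card S) * G\<^sup>2 \<le> (real b - real a) * G + (real (card \<T>) * real (N\<^sup>2))\<^sup>2"
    unfolding G_def h_def
  proof (rule selberg_sieve[where bad = "\<lambda>p n. p dvd n \<and> \<not> p\<^sup>2 dvd n"])
    show "finite \<T>" unfolding \<T>_def by (rule finite_rough_prime_sets)
    show "finite T" if "T \<in> \<T>" for T using TD(1)[OF that] .
    show "0 < p\<^sup>2" if "p \<in> \<Union>\<T>" for p using that TD(2) by (auto dest: prime_gt_0_nat)
    show "coprime (p\<^sup>2) (q\<^sup>2)" if "p \<in> \<Union>\<T>" "q \<in> \<Union>\<T>" "p \<noteq> q" for p q
      using that TD(2) by (auto intro: primes_coprime)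
    show "(p dvd n + p\<^sup>2 \<and> \<not> p\<^sup>2 dvd n + p\<^sup>2) = (p dvd n \<and> \<not> p\<^sup>2 dvd n)" for p n :: nat
      by (auto simp: dvd_add_left_iff power2_eq_square)
    show "card {n \<in> {..<p\<^sup>2}. p dvd n \<and> \<not> p\<^sup>2 dvd n} = p - 1" if "p \<in> \<Union>\<T>" for p
      using that TD(2) by (intro card_exact_multiples) (auto dest: prime_gt_0_nat)
    show "2 * (p - 1) \<le> p\<^sup>2" if "p \<in> \<Union>\<T>" for p
    proof -
      have "p \<ge> 2" using that TD(2) by (auto dest: prime_ge_2_nat)
      hence "2 * p \<le> p * p" by (rule mult_le_mono1)
      moreover have "2 * (p - 1) \<le> 2 * p" by simp
      ultimately show ?thesis unfolding power2_eq_square by (rule order_trans[rotated])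
    qed
    show "(\<Prod>p\<in>T. p\<^sup>2) \<le> N\<^sup>2" if "T \<in> \<T>" for T
      using TD(4)[OF that] by (simp add: power_mono flip: prod_power_distrib)
    show "\<not> (p dvd n \<and> \<not> p\<^sup>2 dvd n)" if "n \<in> S" "p \<in> \<Union>\<T>" for n p
    proof -
      from that(2) obtain T where "T \<in> \<T>" "p \<in> T" by blast
      hence "prime p" "w < real p" using TD(2,3) wW by blast+
      thus ?thesis using that(1) unfolding S_def by (auto simp: not_less[symmetric])
    qed
  qed (rule ab Sab)+

  have hnn: "0 \<le> h p" for p
  proof -
    have "p \<le> p\<^sup>2" by (simp add: power2_eq_square)
    hence "p - 1 \<le> p\<^sup>2" by linarith
    hence "real (p - 1) \<le> real (p\<^sup>2)" by (rule of_nat_mono)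
    thus ?thesis unfolding h_def by (intro divide_nonneg_nonneg) auto
  qed
  have G1: "G \<ge> 1"
  proof -
    have "{} \<in> \<T>" unfolding \<T>_def rough_prime_sets_def using N1 by simp
    hence "(\<Prod>p\<in>{}. h p) \<le> G" unfolding G_def
      using hnn by (intro member_le_sum prod_nonneg) (auto simp: \<T>_def finite_rough_prime_sets)
    thus ?thesis by simp
  qed
  have Glow: "ln y \<le> 72 * exp 3 * ln w * G"
  proof -
    have lnw: "1 / 2 \<le> ln w"
    proof -
      have "1 / 2 \<le> ln (2 :: real)" using ln_le_minus_one[of "1 / 2 :: real"] by (simp add: ln_div)
      also have "\<dots> \<le> ln w" using w by simp
      finally show ?thesis .
    qed
    have "(1 / 12) * ln y = ln D" unfolding D_def using y by (simp add: ln_powr)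
    also have "\<dots> \<le> ln (real N + 1)" using ND D1 by (intro ln_mono) auto
    also have "\<dots> \<le> 2 * (\<Prod>p | prime p \<and> p \<le> W. 1 + 1 / real p) * (\<Sum>T\<in>\<T>. 1 / real (\<Prod>T))"
      unfolding \<T>_def by (rule ln_le_rough_sum)
    also have "\<dots> \<le> 2 * (exp 2 * (3 * ln w)) * (exp 1 * G)"
    proof (intro mult_mono)
      have "(\<Prod>p | prime p \<and> p \<le> W. 1 + 1 / real p) \<le> exp 2 * (1 + ln (real W))"
        by (rule prod_one_plus_inverse_primes_le[OF W2])
      also have "1 + ln (real W) \<le> 3 * ln w"
      proof -
        have "ln (real W) \<le> ln w" using Ww W2 by simp
        thus ?thesis using lnw by simp
      qed
      finally show "(\<Prod>p | prime p \<and> p \<le> W. 1 + 1 / real p) \<le> exp 2 * (3 * ln w)" by simp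
      show "(\<Sum>T\<in>\<T>. 1 / real (\<Prod>T)) \<le> exp 1 * G"
        unfolding G_def h_def sum_distrib_left using TD
        by (intro sum_mono inverse_prod_le_sieve_weight) (auto dest: prime_ge_2_nat)
    qed (use lnw in \<open>auto intro!: sum_nonneg prod_nonneg\<close>)
    also have "\<dots> = 6 * exp 3 * ln w * G"
      using exp_add[of 2 "1::real"] by (simp add: algebra_simps)
    finally show ?thesis by linarith
  qed
  have err: "(real (card \<T>) * real (N\<^sup>2))\<^sup>2 \<le> y powr (1 / 2)"
  proof -
    have "real (card \<T>) * real (N\<^sup>2) \<le> real N * (real N)\<^sup>2"
      using card_rough_prime_sets_le[of W N] unfolding \<T>_def by (intro mult_mono) auto
    also have "\<dots> = real N ^ 3" by (simp add: power2_eq_square power3_eq_cube)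
    also have "\<dots> \<le> D ^ 3" using ND by (intro power_mono) auto
    finally have "(real (card \<T>) * real (N\<^sup>2))\<^sup>2 \<le> (D ^ 3)\<^sup>2" by (intro power_mono) auto
    also have "\<dots> = D ^ 6" by (simp flip: power_mult)
    also have "\<dots> = y powr (1 / 2)" unfolding D_def using y by (simp add: powr_power)
    finally show ?thesis .
  qed
  have "real (card S) * G\<^sup>2 \<le> 2 * y * G + y powr (1 / 2)"
  proof -
    have "(real b - real a) * G \<le> 2 * y * G" using len G1 by (intro mult_right_mono) auto
    thus ?thesis using sieve err by linarith
  qed
  hence "real (card S) \<le> (2 * y * G + y powr (1 / 2)) / G\<^sup>2"
    using G1 by (simp add: pos_le_divide_eq)
  also have "\<dots> = 2 * y / G + y powr (1 / 2) / G\<^sup>2"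
    using G1 by (simp add: add_divide_distrib power2_eq_square)
  also have "y powr (1 / 2) / G\<^sup>2 \<le> y powr (1 / 2)"
  proof -
    have "G\<^sup>2 \<ge> 1" using G1 by (simp add: one_le_power)
    thus ?thesis using divide_left_mono[of 1 "G\<^sup>2" "y powr (1 / 2)"] G1 by fastforce
  qed
  also have "2 * y / G \<le> 144 * exp 3 * (y * ln w / ln y)"
  proof -
    have "ln y > 0" using y by simp
    have "2 * y * ln y \<le> 2 * y * (72 * exp 3 * ln w * G)" using Glow y by (intro mult_left_mono) auto
    thus ?thesis using \<open>ln y > 0\<close> G1 by (simp add: field_simps)
  qed
  finally show ?thesis unfolding S_def by simp
qed

lemma exact_divisor_le_largest_prime_factor:
  assumes "n > 0" "prime p" "p dvd n" "\<not> p\<^sup>2 dvd n"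
  shows "p \<le> largest_prime_factor (simple_prime_part n)"
proof -
  let ?A = "{p \<in> prime_factors n. \<not> p\<^sup>2 dvd n}"
  have pA: "p \<in> ?A" using assms by (auto simp: prime_factors_dvd)
  have pf: "prime_factors (simple_prime_part n) = ?A"
    unfolding simple_prime_part_def by (rule prime_factors_prod_primes) auto
  hence "p dvd simple_prime_part n" using pA by (auto simp: prime_factors_dvd)
  moreover have "simple_prime_part n > 0"
    unfolding simple_prime_part_def by (intro prod_pos) (auto intro: prime_gt_0_nat)
  ultimately have "simple_prime_part n \<ge> 2"
    using dvd_imp_le prime_ge_2_nat[OF assms(2)] le_trans by blast
  thus ?thesis unfolding largest_prime_factor_def using pf pA by simp
qed

theorem theorem2:
  fixes \<eta> :: "real \<Rightarrow> real"
  assumes "\<And>y. y \<ge> 2 \<Longrightarrow> \<eta> y > 0"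
    and "(\<eta> \<longlongrightarrow> 0) at_top"
  shows "\<exists>C>0. \<forall>k w x y :: real.
           k > 1 \<longrightarrow> 2 \<le> w \<longrightarrow> w \<le> y \<longrightarrow> y \<le> x \<longrightarrow> ln w \<le> \<eta> y * ln y \<longrightarrow>
           real (card {n :: nat. x < real n \<and> real n \<le> x + y \<and> k_powered k n \<and>
                          real (largest_prime_factor (simple_prime_part n)) \<le> w})
             \<le> C * (y * ln w / ln y + y * exp (- (ln y / (3 * ln w))) + y powr (11 / 12))"
proof (intro exI[of _ "144 * exp 3"] conjI allI impI)
  fix k w x y :: real
  assume w: "2 \<le> w" and wy: "w \<le> y" and yx: "y \<le> x"
  let ?A = "{n :: nat. x < real n \<and> real n \<le> x + y \<and> k_powered k n \<and>
              real (largest_prime_factor (simple_prime_part n)) \<le> w}"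
  let ?B = "{n :: nat. x < real n \<and> real n \<le> x + y \<and>
              (\<forall>p. prime p \<longrightarrow> p dvd n \<longrightarrow> \<not> p\<^sup>2 dvd n \<longrightarrow> real p \<le> w)}"
  have "finite ?B"
    by (rule finite_subset[of _ "{..nat \<lfloor>x + y\<rfloor>}"]) (auto simp: le_nat_floor)
  moreover have "?A \<subseteq> ?B"
  proof
    fix n assume n: "n \<in> ?A"
    hence "n > 0" using w wy yx by (auto intro: Nat.gr0I)
    have "real p \<le> w" if "prime p" "p dvd n" "\<not> p\<^sup>2 dvd n" for p
      using exact_divisor_le_largest_prime_factor[OF \<open>n > 0\<close> that] n by simp
    thus "n \<in> ?B" using n by blast
  qed
  ultimately have "real (card ?A) \<le> real (card ?B)" by (simp add: card_mono)
  also have "\<dots> \<le> 144 * exp 3 * (y * ln w / ln y) + y powr (1 / 2)"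
    using w wy yx by (intro card_exact_divisors_small_le) auto
  also have "\<dots> \<le> 144 * exp 3 * (y * ln w / ln y) + 144 * exp 3 * y powr (11 / 12)"
  proof -
    have "y powr (1 / 2) \<le> y powr (11 / 12)" using w wy by (intro powr_mono) auto
    also have "\<dots> \<le> 144 * exp 3 * y powr (11 / 12)"
    proof -
      have "1 \<le> exp (3 :: real)" by simp
      hence "1 \<le> 144 * exp (3 :: real)" by linarith
      thus ?thesis by (simp add: mult_le_cancel_right1)
    qed
    finally show ?thesis by simp
  qed
  also have "\<dots> \<le> 144 * exp 3 * (y * ln w / ln y + y * exp (- (ln y / (3 * ln w))) + y powr (11 / 12))"
    using w wy by (simp add: distrib_left)
  finally show "real (card ?A)
      \<le> 144 * exp 3 * (y * ln w / ln y + y * exp (- (ln y / (3 * ln w))) + y powr (11 / 12))" .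
qed simp

end
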